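(* Let $S$ be a semigroup and let $A$ be a finite set. Suppose that the semigroup $S$ admits a left-identity element (e.g., $S$ is a monoid). Let $X\subset A^S$ be a subshift. Then the following conditions are equivalent: (a) the subshift $X$ is of finite type; (b) the dynamical system $(X,S)$ has the pseudo-orbit tracing property.
   Context: A left-identity element of $S$ is an element $e\in S$ with $et=t$ for all $t\in S$. $A^S$ is the set of all maps $S\to A$ with the prodiscrete topology (product topology with each factor $A$ discrete), which is compact Hausdorff. $S$ acts continuously on $A^S$ by the shift $(sx)(s')=x(s's)$ for $s,s'\in S$, $x\in A^S$. A subshift is a closed $S$-invariant subset $X\subset A^S$ (i.e. $sx\in X$ for all $s\in S$, $x\in X$); $(X,S)$ denotes $X$ with the restricted shift action. A subshift $X$ is of finite type if there exist a finite subset $W\subset S$ and $P\subset A^W$ such that $X=\{x\in A^S : (sx)|_W\in P \text{ for all } s\in S\}$. A compact Hausdorff space carries a unique uniform structure inducing its topology; its entourages are the neighborhoods of the diagonal. Pseudo-orbit tracing property: for a finite $K\subset S$ and an entourage $V$ of $X$, a family $(x_s)_{s\in S}$ of points of $X$ is a $(K,V)$-pseudo-orbit if $(kx_s,x_{ks})\in V$ for all $k\in K$, $s\in S$. It is $U$-traced by the orbit of $x\in X$ if $(sx,x_s)\in U$ for all $s\in S$. The system $(X,S)$ has the pseudo-orbit tracing property if for every entourage $U$ of $X$ there exist a finite subset $K\subset S$ and an entourage $V$ of $X$ such that every $(K,V)$-pseudo-orbit is $U$-traced by the orbit of some point of $X$. *)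

theory Defs
  imports "HOL-Analysis.Analysis"
begin

definition left_identity :: "'s::semigroup_mult \<Rightarrow> bool" where
  "left_identity e \<longleftrightarrow> (\<forall>t. e * t = t)"

section \<open>Shifts and subshifts\<close>

definition full_shift :: "'a set \<Rightarrow> ('s \<Rightarrow> 'a) topology" where
  "full_shift A = product_topology (\<lambda>_. discrete_topology A) UNIV"

text \<open>The semigroup acts from the left by translating the argument on the right.\<close>

definition shift :: "'s::semigroup_mult \<Rightarrow> ('s \<Rightarrow> 'a) \<Rightarrow> 's \<Rightarrow> 'a" where
  "shift s x = (\<lambda>t. x (t * s))"

definition subshift :: "'a set \<Rightarrow> ('s::semigroup_mult \<Rightarrow> 'a) set \<Rightarrow> bool" where
  "subshift A X \<longleftrightarrow> closedin (full_shift A) X \<and> (\<forall>s. \<forall>x\<in>X. shift s x \<in> X)"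

text \<open>Elements of \<open>A\<^sup>W\<close> are represented by the extensional functions in \<open>W \<rightarrow>\<^sub>E A\<close>.\<close>

definition finite_type :: "'a set \<Rightarrow> ('s::semigroup_mult \<Rightarrow> 'a) set \<Rightarrow> bool" where
  "finite_type A X \<longleftrightarrow>
     (\<exists>W P. finite W \<and> P \<subseteq> (W \<rightarrow>\<^sub>E A) \<and>
        X = {x \<in> topspace (full_shift A). \<forall>s. restrict (shift s x) W \<in> P})"

section \<open>Pseudo-orbit tracing\<close>

text \<open>For a compact Hausdorff space, the entourages of its unique compatible uniform structure are
  the neighbourhoods of the diagonal; the definition is meant for such spaces only.\<close>

definition entourage :: "'x topology \<Rightarrow> ('x \<times> 'x) set \<Rightarrow> bool" where
  "entourage T V \<longleftrightarrow> V \<subseteq> topspace T \<times> topspace T \<and>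
     (\<exists>G. openin (prod_topology T T) G \<and> Id_on (topspace T) \<subseteq> G \<and> G \<subseteq> V)"

definition pseudo_orbit ::
    "('s::semigroup_mult \<Rightarrow> 'x \<Rightarrow> 'x) \<Rightarrow> 's set \<Rightarrow> ('x \<times> 'x) set \<Rightarrow> ('s \<Rightarrow> 'x) \<Rightarrow> bool" where
  "pseudo_orbit act K V xs \<longleftrightarrow> (\<forall>k\<in>K. \<forall>s. (act k (xs s), xs (k * s)) \<in> V)"

definition traced_by ::
    "('s::semigroup_mult \<Rightarrow> 'x \<Rightarrow> 'x) \<Rightarrow> ('x \<times> 'x) set \<Rightarrow> ('s \<Rightarrow> 'x) \<Rightarrow> 'x \<Rightarrow> bool" where
  "traced_by act U xs x \<longleftrightarrow> (\<forall>s. (act s x, xs s) \<in> U)"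

definition pseudo_orbit_tracing ::
    "'x topology \<Rightarrow> ('s::semigroup_mult \<Rightarrow> 'x \<Rightarrow> 'x) \<Rightarrow> bool" where
  "pseudo_orbit_tracing T act \<longleftrightarrow>
     (\<forall>U. entourage T U \<longrightarrow>
        (\<exists>K V. finite K \<and> entourage T V \<and>
           (\<forall>xs. range xs \<subseteq> topspace T \<and> pseudo_orbit act K V xs \<longrightarrow>
              (\<exists>x\<in>topspace T. traced_by act U xs x))))"

end

theory Submission imports Defs begin

text \<open>
  Compactness of the full shift over a finite alphabet reduces uniform closeness to combinatorics:
  every entourage of a subshift contains the relation of agreeing on \<open>F\<close>, for some finite set \<open>F\<close> of
  coordinates (\<open>entourage_contains_agree\<close>), and each such relation is an entourage
  (\<open>entourage_agree\<close>). So pseudo-orbits and tracing only concern finite windows.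

  The bridge between points and families of points is a left identity \<open>e\<close>: since
  \<open>shift s x e = x (e * s) = x s\<close>, a configuration \<open>x\<close> can be read off from the values at \<open>e\<close> of
  its orbit.

  If \<open>X\<close> is defined by patterns on a finite window \<open>W\<close>, a pseudo-orbit \<open>xs\<close> whose errors are
  invisible at the coordinate \<open>e\<close> glues to the configuration \<open>x s = xs s e\<close>. For \<open>k\<close> in the finite
  set of the pseudo-orbit condition, \<open>x (k * s) = xs s k\<close>, so near each \<open>s\<close> the configuration looks
  like the point \<open>xs s\<close> of \<open>X\<close>; it therefore satisfies the local rule and traces \<open>xs\<close>
  (\<open>finite_type_imp_pseudo_orbit_tracing\<close>).

  Conversely, let pseudo-orbits be traced up to agreement at \<open>e\<close>. A configuration \<open>y\<close> whose windows
  all occur in points of \<open>X\<close> yields points \<open>xs s\<close> of \<open>X\<close> that look like \<open>shift s y\<close> on the window.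
  If the window is large enough they form a pseudo-orbit, and a point of \<open>X\<close> tracing it
  has the same value as \<open>y\<close> at every \<open>e * s = s\<close>. Thus \<open>X\<close> is determined by
  its patterns on that window (\<open>pseudo_orbit_tracing_imp_finite_type\<close>).
\<close>

definition agree :: "('s \<Rightarrow> 'a) set \<Rightarrow> 's set \<Rightarrow> (('s \<Rightarrow> 'a) \<times> ('s \<Rightarrow> 'a)) set" where
  "agree X F = {(x, y). x \<in> X \<and> y \<in> X \<and> (\<forall>t\<in>F. x t = y t)}"

definition cylinder :: "('s \<Rightarrow> 'a) set \<Rightarrow> 's set \<Rightarrow> ('s \<Rightarrow> 'a) \<Rightarrow> ('s \<Rightarrow> 'a) set" where
  "cylinder X F x = {y \<in> X. \<forall>t\<in>F. y t = x t}"

lemma topspace_full_shift: "topspace (full_shift A) = {x. \<forall>t. x t \<in> A}"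
  by (auto simp: full_shift_def PiE_def Pi_def)

lemma compact_space_full_shift:
  assumes "finite A"
  shows "compact_space (full_shift A)"
  unfolding full_shift_def
  using assms by (auto simp: compact_space_product_topology compact_space_discrete_topology)

lemma openin_cylinder:
  assumes "finite F" and "X \<subseteq> topspace (full_shift A)" and "x \<in> X"
  shows "openin (subtopology (full_shift A) X) (cylinder X F x)"
proof -
  let ?B = "PiE UNIV (\<lambda>t. if t \<in> F then {x t} else A)"
  have "openin (full_shift A) ?B"
    unfolding full_shift_def
    by (rule product_topology_basis)
      (use assms in \<open>auto simp: topspace_full_shift intro: rev_finite_subset\<close>)
  moreover have "cylinder X F x = ?B \<inter> X"
    using assms by (auto simp: cylinder_def topspace_full_shift PiE_def Pi_def split: if_splits)
  ultimately show ?thesis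
    by (auto simp: openin_subtopology)
qed

lemma cylinder_neighbourhood:
  assumes "X \<subseteq> topspace (full_shift A)"
    and "openin (subtopology (full_shift A) X) G" and "x \<in> G"
  obtains F where "finite F" and "cylinder X F x \<subseteq> G"
proof -
  obtain H where H: "openin (full_shift A) H" "G = H \<inter> X"
    using assms(2) by (auto simp: openin_subtopology)
  then have "x \<in> H" using assms(3) by auto
  from product_topology_open_contains_basis[OF H(1)[unfolded full_shift_def] this]
  obtain B where B: "x \<in> PiE UNIV B" "PiE UNIV B \<subseteq> H" "finite {i. B i \<noteq> A}"
    unfolding topspace_discrete_topology by (elim exE conjE)
  let ?F = "{i. B i \<noteq> A}"
  have "y \<in> G" if y: "y \<in> cylinder X ?F x" for y
  proof -
    have "y i \<in> B i" for i
    proof (cases "B i = A")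
      case True
      then show ?thesis using y assms(1) by (auto simp: cylinder_def topspace_full_shift)
    next
      case False
      then have "y i = x i" using y by (auto simp: cylinder_def)
      then show ?thesis using B(1) by auto
    qed
    then have "y \<in> H" using B(2) by auto
    then show ?thesis using y H(2) by (auto simp: cylinder_def)
  qed
  then show ?thesis
    using that[of ?F] B(3) by auto
qed

lemma entourage_agree:
  assumes "finite F" and "X \<subseteq> topspace (full_shift A)"
  shows "entourage (subtopology (full_shift A) X) (agree X F)"
proof -
  let ?T = "subtopology (full_shift A) X"
  have X: "topspace ?T = X" using assms(2) by (simp add: Int_absorb1)
  let ?G = "\<Union>x\<in>X. cylinder X F x \<times> cylinder X F x"
  have "openin (prod_topology ?T ?T) ?G"
    using openin_cylinder[OF assms] by (intro openin_Union) (auto simp: openin_prod_Times_iff)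
  moreover have "Id_on X \<subseteq> ?G" "?G \<subseteq> agree X F" "agree X F \<subseteq> X \<times> X"
    by (auto simp: cylinder_def agree_def)
  ultimately show ?thesis
    unfolding entourage_def X by blast
qed

text \<open>
  Around each diagonal point the entourage contains the square of a cylinder. Finitely many of
  these cylinders cover \<open>X\<close>, and two points that agree on all their coordinates lie in a common one.
\<close>

lemma entourage_contains_agree:
  assumes "finite A" and "closedin (full_shift A) X"
    and "entourage (subtopology (full_shift A) X) U"
  obtains F where "finite F" and "agree X F \<subseteq> U"
proof -
  let ?T = "subtopology (full_shift A) X"
  have XT: "X \<subseteq> topspace (full_shift A)" using assms(2) by (rule closedin_subset)
  then have X: "topspace ?T = X" by (simp add: Int_absorb1)
  obtain G where G: "openin (prod_topology ?T ?T) G" "Id_on X \<subseteq> G" "G \<subseteq> U"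
    using assms(3) unfolding entourage_def X by blast
  have "\<exists>F. finite F \<and> cylinder X F x \<times> cylinder X F x \<subseteq> G" if x: "x \<in> X" for x
  proof -
    have "(x, x) \<in> G" using G(2) x by auto
    with G(1)[unfolded openin_prod_topology_alt, rule_format]
    obtain O1 O2 where O: "openin ?T O1" "openin ?T O2" "x \<in> O1" "x \<in> O2" "O1 \<times> O2 \<subseteq> G"
      by meson
    obtain F where "finite F" "cylinder X F x \<subseteq> O1 \<inter> O2"
      using cylinder_neighbourhood[OF XT openin_Int[OF O(1,2)] IntI[OF O(3,4)]] .
    then show ?thesis using O(5) by blast
  qed
  then obtain f where f: "\<And>x. x \<in> X \<Longrightarrow> finite (f x)"
      "\<And>x. x \<in> X \<Longrightarrow> cylinder X (f x) x \<times> cylinder X (f x) x \<subseteq> G"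
    by metis
  have "compact_space ?T"
    using closedin_compact_space[OF compact_space_full_shift[OF assms(1)] assms(2)]
    by (simp add: compact_space_subtopology)
  moreover have "\<And>C. C \<in> (\<lambda>x. cylinder X (f x) x) ` X \<Longrightarrow> openin ?T C"
    using openin_cylinder[OF f(1) XT] by auto
  moreover have "X \<subseteq> \<Union> ((\<lambda>x. cylinder X (f x) x) ` X)"
    by (auto simp: cylinder_def)
  ultimately have "\<exists>\<F>. finite \<F> \<and> \<F> \<subseteq> (\<lambda>x. cylinder X (f x) x) ` X \<and> X \<subseteq> \<Union>\<F>"
    unfolding compact_space_alt X by blast
  then obtain Y where Y: "Y \<subseteq> X" "finite Y" "X \<subseteq> (\<Union>x\<in>Y. cylinder X (f x) x)"
    by (metis (no_types, lifting) finite_subset_image)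
  let ?F = "\<Union>x\<in>Y. f x"
  have "(y, z) \<in> G" if yz: "(y, z) \<in> agree X ?F" for y z
  proof -
    have "y \<in> X" using yz by (simp add: agree_def)
    then obtain x where x: "x \<in> Y" "y \<in> cylinder X (f x) x" using Y(3) by blast
    then have "z \<in> cylinder X (f x) x" using yz by (auto simp: cylinder_def agree_def)
    then show ?thesis using f(2) x Y(1) by blast
  qed
  then have "agree X ?F \<subseteq> U" using G(3) by auto
  moreover have "finite ?F" using Y(1,2) f(1) by blast
  ultimately show ?thesis using that by blast
qed

text \<open>
  The window \<open>W\<close> of the local rule enters the pseudo-orbit condition as its translate \<open>W * e\<close>,
  because \<open>e\<close> need not be a right identity: of a point \<open>xs s\<close> of \<open>X\<close> the local rule only controls
  translates, such as \<open>shift e (xs s)\<close>, whose coordinates in \<open>W\<close> are those of \<open>xs s\<close> in \<open>W * e\<close>.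
  Nothing is lost on the glued configuration, as \<open>w * e * s = w * s\<close>.
\<close>

lemma finite_type_imp_pseudo_orbit_tracing:
  fixes X :: "('s::semigroup_mult \<Rightarrow> 'a) set"
  assumes e: "left_identity (e :: 's)" and "finite A" and X: "subshift A X"
    and "finite_type A X"
  shows "pseudo_orbit_tracing (subtopology (full_shift A) X) shift"
  unfolding pseudo_orbit_tracing_def
proof (intro allI impI)
  let ?T = "subtopology (full_shift A) X"
  fix U assume U: "entourage ?T U"
  have e: "e * t = t" for t using e by (simp add: left_identity_def)
  have closed: "closedin (full_shift A) X" using X by (simp add: subshift_def)
  then have XT: "X \<subseteq> topspace (full_shift A)" by (rule closedin_subset)
  then have T: "topspace ?T = X" by (simp add: Int_absorb1)
  obtain F where F: "finite F" "agree X F \<subseteq> U"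
    using entourage_contains_agree[OF assms(2) closed U] .
  obtain W P where W: "finite W"
      "X = {x \<in> topspace (full_shift A). \<forall>s. restrict (shift s x) W \<in> P}"
    using assms(4) unfolding finite_type_def by blast
  let ?K = "F \<union> (\<lambda>w. w * e) ` W"
  have "\<exists>x\<in>X. traced_by shift U xs x"
    if xs: "range xs \<subseteq> X" "pseudo_orbit shift ?K (agree X {e}) xs" for xs
  proof -
    define x where "x = (\<lambda>s. xs s e)"
    have glue: "x (k * s) = xs s k" if "k \<in> ?K" for k s
    proof -
      have "(shift k (xs s), xs (k * s)) \<in> agree X {e}"
        using xs(2) that unfolding pseudo_orbit_def by blast
      then show ?thesis by (simp add: agree_def shift_def x_def e)
    qed
    have "xs s \<in> X" for s using xs(1) by blast
    have "x \<in> topspace (full_shift A)"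
      using xs(1) XT by (auto simp: x_def topspace_full_shift)
    moreover have "restrict (shift s x) W \<in> P" for s
    proof -
      have "shift s x w = shift e (xs s) w" if "w \<in> W" for w
        using glue[of "w * e" s] that by (simp add: shift_def mult.assoc e)
      then have "restrict (shift s x) W = restrict (shift e (xs s)) W" by auto
      then show ?thesis using \<open>xs s \<in> X\<close> W(2) by auto
    qed
    ultimately have "x \<in> X" by (subst W(2)) simp
    moreover have "(shift s x, xs s) \<in> U" for s
    proof -
      have "shift s x \<in> X" using X \<open>x \<in> X\<close> by (simp add: subshift_def)
      moreover have "\<forall>t\<in>F. shift s x t = xs s t" using glue by (simp add: shift_def)
      ultimately show ?thesis using F(2) \<open>xs s \<in> X\<close> by (auto simp: agree_def)
    qed
    ultimately show ?thesis by (auto simp: traced_by_def)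
  qed
  moreover have "entourage ?T (agree X {e})" by (rule entourage_agree[OF _ XT]) simp
  moreover have "finite ?K" using F(1) W(1) by simp
  ultimately show "\<exists>K V. finite K \<and> entourage ?T V \<and>
      (\<forall>xs. range xs \<subseteq> topspace ?T \<and> pseudo_orbit shift K V xs \<longrightarrow>
         (\<exists>x\<in>topspace ?T. traced_by shift U xs x))"
    unfolding T by blast
qed

text \<open>
  With pseudo-orbits controlled by \<open>K\<close> and by agreement on \<open>F\<close>, comparing \<open>shift k (xs s)\<close> with
  \<open>xs (k * s)\<close> on \<open>F\<close> involves \<open>xs s\<close> on \<open>F * K\<close> and \<open>xs (k * s)\<close> on \<open>F\<close>; the coordinate \<open>e\<close> is
  where the tracing point is compared. The window is the union of these three sets.
\<close>

lemma pseudo_orbit_tracing_imp_finite_type: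
  fixes X :: "('s::semigroup_mult \<Rightarrow> 'a) set"
  assumes e: "left_identity (e :: 's)" and "finite A" and X: "subshift A X"
    and tracing: "pseudo_orbit_tracing (subtopology (full_shift A) X) shift"
  shows "finite_type A X"
proof -
  let ?T = "subtopology (full_shift A) X"
  have e: "e * t = t" for t using e by (simp add: left_identity_def)
  have closed: "closedin (full_shift A) X" using X by (simp add: subshift_def)
  then have XT: "X \<subseteq> topspace (full_shift A)" by (rule closedin_subset)
  then have T: "topspace ?T = X" by (simp add: Int_absorb1)
  have "entourage ?T (agree X {e})" by (rule entourage_agree[OF _ XT]) simp
  then obtain K V where K: "finite K" and V: "entourage ?T V"
    and trace: "\<And>xs. range xs \<subseteq> X \<Longrightarrow> pseudo_orbit shift K V xs \<Longrightarrow>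
        \<exists>x\<in>X. traced_by shift (agree X {e}) xs x"
    using tracing unfolding pseudo_orbit_tracing_def T by metis
  obtain F where F: "finite F" "agree X F \<subseteq> V"
    using entourage_contains_agree[OF assms(2) closed V] .
  define W where "W = insert e (F \<union> (\<lambda>(f, k). f * k) ` (F \<times> K))"
  define P where "P = (\<lambda>x. restrict x W) ` X"
  have "y \<in> X" if y: "y \<in> topspace (full_shift A)" "\<And>s. restrict (shift s y) W \<in> P" for y
  proof -
    have "\<forall>s. \<exists>x\<in>X. restrict (shift s y) W = restrict x W"
      using y(2) unfolding P_def by blast
    then obtain xs where xs: "\<And>s. xs s \<in> X" "\<And>s. restrict (shift s y) W = restrict (xs s) W"
      by metis
    have window: "xs s w = y (w * s)" if "w \<in> W" for s w
      using fun_cong[OF xs(2)[of s], of w] that by (simp add: shift_def)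
    have "pseudo_orbit shift K V xs"
      unfolding pseudo_orbit_def
    proof (intro ballI allI)
      fix k s assume k: "k \<in> K"
      have "shift k (xs s) f = xs (k * s) f" if f: "f \<in> F" for f
      proof -
        have "f * k \<in> W" "f \<in> W" using f k by (auto simp: W_def)
        then show ?thesis by (simp add: shift_def window mult.assoc)
      qed
      moreover have "shift k (xs s) \<in> X" using X xs(1) by (simp add: subshift_def)
      ultimately show "(shift k (xs s), xs (k * s)) \<in> V"
        using F(2) xs(1) by (auto simp: agree_def)
    qed
    then obtain x where x: "x \<in> X" "traced_by shift (agree X {e}) xs x"
      using trace[of xs] xs(1) by blast
    have "x s = y s" for s
    proof -
      have "shift s x e = xs s e" using x(2) by (auto simp: traced_by_def agree_def)
      then show ?thesis using window[of e s] by (simp add: W_def shift_def e)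
    qed
    then have "x = y" by auto
    then show ?thesis using x(1) by simp
  qed
  moreover have "restrict (shift s x) W \<in> P" if "x \<in> X" for x s
    using X that by (simp add: subshift_def P_def)
  ultimately have "X = {x \<in> topspace (full_shift A). \<forall>s. restrict (shift s x) W \<in> P}"
    using XT by blast
  moreover have "finite W" using F(1) K by (simp add: W_def)
  moreover have "P \<subseteq> (W \<rightarrow>\<^sub>E A)"
    using XT by (auto simp: P_def topspace_full_shift)
  ultimately show ?thesis unfolding finite_type_def by blast
qed

theorem theorem4p10:
  fixes A :: "'a set" and X :: "('s::semigroup_mult \<Rightarrow> 'a) set"
  assumes "\<exists>e::'s. left_identity e"
    and "finite A"
    and "subshift A X"
  shows "finite_type A X \<longleftrightarrow>
         pseudo_orbit_tracing (subtopology (full_shift A) X) shift"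
  using assms finite_type_imp_pseudo_orbit_tracing pseudo_orbit_tracing_imp_finite_type
  by blast

end
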